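(* Let $\dot A$ be a closed, densely defined symmetric operator with deficiency indices $(1,1)$ in a Hilbert space, $A$ a self-adjoint extension of $\dot A$, and $\widehat A\ne(\widehat A)^*$ a maximal dissipative extension of $\dot A$. Let $\mathcal M=\mathcal M(\widehat A)$ be the Weyl–Titchmarsh function of $\widehat A$ and $S=S(\dot A,\widehat A,A)$ the characteristic function of the triple $(\dot A,\widehat A,A)$. Then, with $\kappa=S(i)$, $$\overline\kappa\,S(z)=\frac{|\kappa|^2-1}{2i}\,\mathcal M(z)+\frac{|\kappa|^2+1}{2},\qquad z\in\mathbb C_+ .$$
   Context: $\mathbb C_+$ is the open upper half-plane; inner products are linear in the first argument. A maximal dissipative extension $\widehat A$ of $\dot A$ is a maximal operator extending $\dot A$ with $\operatorname{Im}(\widehat Af,f)\ge0$ on $\operatorname{Dom}(\widehat A)$; it satisfies $\dot A\subset\widehat A\subset(\dot A)^*$. Choose $g_\pm\in\operatorname{Ker}((\dot A)^*\mp iI)$, $\|g_\pm\|=1$, with $g_+-g_-\in\operatorname{Dom}(A)$, and let $\kappa$, $|\kappa|<1$, be the number with $g_+-\kappa g_-\in\operatorname{Dom}(\widehat A)$. The Livšic function of $(\dot A,A)$ is $s(z)=\frac{z-i}{z+i}\cdot\frac{(g_z,g_-)}{(g_z,g_+)}$, $z\in\mathbb C_+$, with $0\ne g_z\in\operatorname{Ker}((\dot A)^*-zI)$ arbitrary. The characteristic function of the triple is $$S(z)=\frac{s(z)-\kappa}{\overline\kappa\,s(z)-1},\quad z\in\mathbb C_+,$$ so that $S(i)=\kappa$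 (since $s(i)=0$). The Weyl–Titchmarsh function of $\widehat A$ is $$\mathcal M(z)=\left(((\widehat A)^*z+I)((\widehat A)^*-zI)^{-1}g_+,g_+\right),\quad z\in\mathbb C_+ .$$ *)

theory Defs
  imports "HOL-Analysis.Analysis"
begin

text \<open>
  Complex inner product spaces, built on top of \<^class>\<open>real_inner\<close> so that norm, topology and
  completeness are the library's. The inner product is linear in the first argument.
\<close>

class complex_inner = real_inner +
  fixes scaleC :: "complex \<Rightarrow> 'a \<Rightarrow> 'a" (infixr "*\<^sub>C" 75)
    and cinner :: "'a \<Rightarrow> 'a \<Rightarrow> complex"
  assumes scaleC_add_right: "c *\<^sub>C (x + y) = c *\<^sub>C x + c *\<^sub>C y"
    and scaleC_add_left: "(c + d) *\<^sub>C x = c *\<^sub>C x + d *\<^sub>C x"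
    and scaleC_scaleC: "c *\<^sub>C (d *\<^sub>C x) = (c * d) *\<^sub>C x"
    and scaleC_one: "1 *\<^sub>C x = x"
    and scaleR_scaleC: "r *\<^sub>R x = complex_of_real r *\<^sub>C x"
    and cinner_commute: "cinner x y = cnj (cinner y x)"
    and cinner_add_left: "cinner (x + y) w = cinner x w + cinner y w"
    and cinner_scaleC_left: "cinner (c *\<^sub>C x) y = c * cinner x y"
    and inner_eq_Re_cinner: "inner x y = Re (cinner x y)"

class complex_hilbert_space = complex_inner + complete_space

global_interpretation cvec: vector_space "scaleC :: complex \<Rightarrow> 'a \<Rightarrow> 'a::complex_inner"
  by unfold_locales (simp_all add: scaleC_add_right scaleC_add_left scaleC_scaleC scaleC_one)

text \<open>
  An unbounded operator is represented by its graph, so that extension of operators is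
  \<open>\<subseteq>\<close>, equality (including equality of domains) is \<open>=\<close>, the domain is \<^const>\<open>Domain\<close>, and
  a closed operator is a graph that is \<^const>\<open>closed\<close> in the product topology.
\<close>

definition linear_operator :: "('a::complex_inner \<times> 'a) set \<Rightarrow> bool" where
  "linear_operator T \<longleftrightarrow> single_valued T \<and> (0, 0) \<in> T
     \<and> (\<forall>f h f' h'. (f, h) \<in> T \<and> (f', h') \<in> T \<longrightarrow> (f + f', h + h') \<in> T)
     \<and> (\<forall>c f h. (f, h) \<in> T \<longrightarrow> (c *\<^sub>C f, c *\<^sub>C h) \<in> T)"

definition op_apply :: "('a::complex_inner \<times> 'a) set \<Rightarrow> 'a \<Rightarrow> 'a" where
  "op_apply T f = (THE h. (f, h) \<in> T)"

definition densely_defined :: "('a::complex_inner \<times> 'a) set \<Rightarrow> bool" where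
  "densely_defined T \<longleftrightarrow> closure (Domain T) = UNIV"

text \<open>The adjoint; its graph is single-valued exactly when \<open>T\<close> is densely defined.\<close>

definition op_adjoint :: "('a::complex_inner \<times> 'a) set \<Rightarrow> ('a \<times> 'a) set" where
  "op_adjoint T = {(g, k). \<forall>(f, h)\<in>T. cinner h g = cinner f k}"

definition symmetric_operator :: "('a::complex_inner \<times> 'a) set \<Rightarrow> bool" where
  "symmetric_operator T \<longleftrightarrow> linear_operator T
     \<and> (\<forall>(f, h)\<in>T. \<forall>(g, k)\<in>T. cinner h g = cinner f k)"

definition self_adjoint_operator :: "('a::complex_inner \<times> 'a) set \<Rightarrow> bool" where
  "self_adjoint_operator T \<longleftrightarrow> linear_operator T \<and> densely_defined T \<and> op_adjoint T = T"

definition dissipative_operator :: "('a::complex_inner \<times> 'a) set \<Rightarrow> bool" where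
  "dissipative_operator T \<longleftrightarrow> linear_operator T \<and> (\<forall>(f, h)\<in>T. 0 \<le> Im (cinner h f))"

definition maximal_dissipative_extension ::
    "('a::complex_inner \<times> 'a) set \<Rightarrow> ('a \<times> 'a) set \<Rightarrow> bool" where
  "maximal_dissipative_extension T0 T \<longleftrightarrow> T0 \<subseteq> T \<and> dissipative_operator T
     \<and> (\<forall>T'. dissipative_operator T' \<and> T \<subseteq> T' \<longrightarrow> T' = T)"

text \<open>\<open>Ker (T - zI)\<close>.\<close>

definition eigenspace_op :: "('a::complex_inner \<times> 'a) set \<Rightarrow> complex \<Rightarrow> 'a set" where
  "eigenspace_op T z = {f. (f, z *\<^sub>C f) \<in> T}"

text \<open>
  Complex dimensions of \<open>Ker (T* - iI)\<close> and \<open>Ker (T* + iI)\<close>. As usual for \<open>dim\<close>, an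
  infinite-dimensional space is given dimension 0, so only positive values are informative.
\<close>

definition deficiency_indices :: "('a::complex_inner \<times> 'a) set \<Rightarrow> nat \<times> nat" where
  "deficiency_indices T =
     (cvec.dim (eigenspace_op (op_adjoint T) \<i>), cvec.dim (eigenspace_op (op_adjoint T) (- \<i>)))"

text \<open>The inverse of \<open>T - zI\<close>, again as a graph.\<close>

definition resolvent_op :: "('a::complex_inner \<times> 'a) set \<Rightarrow> complex \<Rightarrow> ('a \<times> 'a) set" where
  "resolvent_op T z = {(h - z *\<^sub>C f, f) | f h. (f, h) \<in> T}"

text \<open>
  Below, \<open>gp\<close> and \<open>gm\<close> are the normalized deficiency vectors \<open>g\<^sub>+\<close> and \<open>g\<^sub>-\<close>, and \<open>g z\<close> is the
  chosen nonzero element of \<open>Ker (T* - zI)\<close> for \<open>T\<close> the underlying symmetric operator;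
  the dependence on that operator and on its self-adjoint reference extension is through them.
\<close>

definition livsic_function :: "'a::complex_inner \<Rightarrow> 'a \<Rightarrow> (complex \<Rightarrow> 'a) \<Rightarrow> complex \<Rightarrow> complex" where
  "livsic_function gp gm g z = (z - \<i>) / (z + \<i>) * (cinner (g z) gm / cinner (g z) gp)"

definition von_neumann_parameter :: "('a::complex_inner \<times> 'a) set \<Rightarrow> 'a \<Rightarrow> 'a \<Rightarrow> complex" where
  "von_neumann_parameter Ahat gp gm =
     (THE \<kappa>. cmod \<kappa> < 1 \<and> gp - \<kappa> *\<^sub>C gm \<in> Domain Ahat)"

definition characteristic_function ::
    "('a::complex_inner \<times> 'a) set \<Rightarrow> 'a \<Rightarrow> 'a \<Rightarrow> (complex \<Rightarrow> 'a) \<Rightarrow> complex \<Rightarrow> complex" where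
  "characteristic_function Ahat gp gm g z =
     (let \<kappa> = von_neumann_parameter Ahat gp gm; s = livsic_function gp gm g
      in (s z - \<kappa>) / (cnj \<kappa> * s z - 1))"

definition weyl_titchmarsh_function ::
    "('a::complex_inner \<times> 'a) set \<Rightarrow> 'a \<Rightarrow> complex \<Rightarrow> complex" where
  "weyl_titchmarsh_function Ahat gp z =
     (let f = op_apply (resolvent_op (op_adjoint Ahat) z) gp
      in cinner (z *\<^sub>C op_apply (op_adjoint Ahat) f + f) gp)"

end

theory Submission
  imports Defs
begin

text \<open>
  Write \<open>T\<close> for the symmetric operator. By von Neumann's decomposition every \<open>f \<in> Dom T*\<close> is
  \<open>f = u + a g\<^sub>+ + b g\<^sub>-\<close> with \<open>u \<in> Dom T\<close>, and Green's identity
  \<open>(T* f, f') - (f, T* f') = 2\<i> (a cnj a' - b cnj b')\<close> shows that everything relevant about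
  extensions of \<open>T\<close> happens at the level of the pairs \<open>(a, b)\<close>.

  In particular \<open>Im (T* f, f) = |a|\<^sup>2 - |b|\<^sup>2\<close>, so a maximal dissipative extension is given by a
  boundary condition \<open>b = -\<kappa>a\<close> with \<open>|\<kappa>| \<le> 1\<close>, and its adjoint by \<open>a = - cnj \<kappa> b\<close>. The two
  conditions coincide when \<open>|\<kappa>| = 1\<close>; an extension different from its adjoint therefore has
  \<open>|\<kappa>| < 1\<close>, and \<open>\<kappa>\<close> is its von Neumann parameter. (\<open>maximal_dissipative_eq_extension\<close>,
  \<open>op_adjoint_extension\<close>, \<open>extension_self_adjoint\<close>.)

  Pairing \<open>g\<^sub>z\<close> with \<open>g\<^sub>+\<close> and \<open>g\<^sub>-\<close> in Green's identity gives \<open>s(z) = - b/a\<close> for the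
  coefficients of \<open>g\<^sub>z\<close>. If \<open>f\<close> solves \<open>(T* - z) f = g\<^sub>+\<close> with the boundary condition of the
  adjoint and has coefficients \<open>X = - cnj \<kappa> Y\<close> and \<open>Y\<close>, then \<open>M(z) = \<i> + 2\<i> (z - \<i>) X\<close>. The vector
  \<open>(z - \<i>) f + g\<^sub>+\<close> is an eigenvector of \<open>T*\<close> for \<open>z\<close>, with coefficients \<open>(z - \<i>) X + 1\<close> and
  \<open>(z - \<i>) Y\<close>, whose ratio is again governed by \<open>s(z)\<close>. Solving for \<open>X\<close> yields
  \<open>M(z) = \<i> + 2\<i> cnj \<kappa> s(z) / (1 - cnj \<kappa> s(z))\<close> (\<open>weyl_titchmarsh_extension\<close>). The relation
  between \<open>M\<close> and \<open>S = (s - \<kappa>) / (cnj \<kappa> s - 1)\<close> is then an identity between Moebius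
  transforms of \<open>cnj \<kappa> s(z)\<close>.
\<close>

section \<open>Complex inner products and orthogonal projection\<close>

lemma cinner_add_right: "cinner x (y + w) = cinner x y + cinner x w"
  by (metis cinner_add_left cinner_commute complex_cnj_add)

lemma cinner_scaleC_right: "cinner x (c *\<^sub>C y) = cnj c * cinner x y"
  by (metis cinner_commute cinner_scaleC_left complex_cnj_mult)

lemma cinner_zero_left: "cinner 0 x = 0"
  by (metis add_cancel_right_right cinner_add_left)

lemma cinner_zero_right: "cinner x 0 = 0"
  by (metis cinner_commute cinner_zero_left complex_cnj_zero)

lemma cinner_diff_left: "cinner (x - y) w = cinner x w - cinner y w"
  by (metis add_diff_cancel_right' cinner_add_left diff_add_cancel)

lemma cinner_diff_right: "cinner x (y - w) = cinner x y - cinner x w"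
  by (metis add_diff_cancel_right' cinner_add_right diff_add_cancel)

lemmas cinner_linear = cinner_add_left cinner_add_right cinner_scaleC_left cinner_scaleC_right
  cinner_zero_left cinner_zero_right cinner_diff_left cinner_diff_right

lemmas scaleC_distribs = cvec.scale_left_distrib cvec.scale_right_distrib
  cvec.scale_left_diff_distrib cvec.scale_right_diff_distrib

lemma cinner_self: "cinner x x = complex_of_real ((norm x)\<^sup>2)"
proof -
  have "cinner x x = cnj (cinner x x)"
    by (rule cinner_commute)
  then have "Im (cinner x x) = 0"
    by (metis cnj.simps(2) equal_neg_zero)
  moreover have "Re (cinner x x) = (norm x)\<^sup>2"
    by (metis inner_eq_Re_cinner power2_norm_eq_inner)
  ultimately show ?thesis
    by (simp add: complex_eq_iff)
qed

lemma Im_cinner: "Im (cinner x y) = inner x (\<i> *\<^sub>C y)"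
  by (simp add: inner_eq_Re_cinner cinner_scaleC_right)

lemma norm_imaginary_scaleC: "norm (\<i> *\<^sub>C y) = norm (y::'a::complex_inner)"
proof -
  have "inner (\<i> *\<^sub>C y) (\<i> *\<^sub>C y) = inner y y"
    by (simp add: inner_eq_Re_cinner cinner_linear)
  then show ?thesis
    by (simp add: norm_eq_sqrt_inner)
qed

lemma cinner_eq_zero_of_inner:
  assumes "inner x y = 0" "inner x (\<i> *\<^sub>C y) = 0"
  shows "cinner x y = 0"
  using assms by (simp add: complex_eq_iff Im_cinner inner_eq_Re_cinner[symmetric])

text \<open>
  The parallelogram law makes every minimizing sequence of the distance to \<open>S\<close> a Cauchy
  sequence; at a minimizer, moving along any direction of \<open>S\<close> cannot decrease the distance.
\<close>

lemma orthogonal_projection_exists: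
  fixes S :: "'a::{real_inner, complete_space} set"
  assumes sub: "subspace S" and cl: "closed S"
  obtains s where "s \<in> S" "\<And>y. y \<in> S \<Longrightarrow> inner (x - s) y = 0"
proof -
  define d where "d = infdist x S"
  have ne: "S \<noteq> {}" using sub subspace_0 by blast
  have d0: "0 \<le> d" by (simp add: d_def infdist_nonneg)
  have dle: "d \<le> norm (x - y)" if "y \<in> S" for y
    using infdist_le[OF that, of x] by (simp add: d_def dist_norm)
  have "\<exists>y\<in>S. norm (x - y) < d + inverse (real (Suc n))" for n
  proof -
    have "infdist x S < d + inverse (real (Suc n))" by (simp add: d_def)
    moreover have "d + inverse (real (Suc n)) \<le> infdist x S"
      if "\<And>y. y \<in> S \<Longrightarrow> d + inverse (real (Suc n)) \<le> norm (x - y)"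
      unfolding infdist_notempty[OF ne] using that by (intro cINF_greatest[OF ne]) (simp add: dist_norm)
    ultimately show ?thesis by (meson not_le)
  qed
  then obtain s where sS: "\<And>n. s n \<in> S"
    and sd: "\<And>n. norm (x - s n) < d + inverse (real (Suc n))"
    by metis
  have par: "(norm (y - y'))\<^sup>2 \<le> 2 * (norm (x - y))\<^sup>2 + 2 * (norm (x - y'))\<^sup>2 - 4 * d\<^sup>2"
    if "y \<in> S" "y' \<in> S" for y y'
  proof -
    have "(1/2) *\<^sub>R (y + y') \<in> S"
      using that sub by (simp add: subspace_add subspace_scale)
    then have "d\<^sup>2 \<le> (norm (x - (1/2) *\<^sub>R (y + y')))\<^sup>2"
      using dle d0 by (simp add: power_mono)
    moreover have "(norm (y - y'))\<^sup>2 + 4 * (norm (x - (1/2) *\<^sub>R (y + y')))\<^sup>2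
        = 2 * (norm (x - y))\<^sup>2 + 2 * (norm (x - y'))\<^sup>2"
      by (simp add: power2_norm_eq_inner inner_diff_left inner_diff_right inner_add_left
          inner_add_right inner_commute algebra_simps)
    ultimately show ?thesis by linarith
  qed
  have lim: "(\<lambda>n. norm (x - s n)) \<longlonglongrightarrow> d"
  proof (rule tendsto_sandwich)
    show "\<forall>\<^sub>F n in sequentially. d \<le> norm (x - s n)"
      using dle sS by simp
    show "\<forall>\<^sub>F n in sequentially. norm (x - s n) \<le> d + inverse (real (Suc n))"
      using sd less_imp_le by (intro always_eventually) blast
    show "(\<lambda>n. d + inverse (real (Suc n))) \<longlonglongrightarrow> d"
      using tendsto_add[OF tendsto_const[of d] LIMSEQ_inverse_real_of_nat] by simp
  qed simp
  have "Cauchy s"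
  proof (rule metric_CauchyI)
    fix e :: real assume e: "e > 0"
    have "(\<lambda>n. (norm (x - s n))\<^sup>2) \<longlonglongrightarrow> d\<^sup>2"
      using lim by (intro tendsto_power)
    moreover have "d\<^sup>2 < d\<^sup>2 + e\<^sup>2 / 4" using e by simp
    ultimately have "\<forall>\<^sub>F n in sequentially. (norm (x - s n))\<^sup>2 < d\<^sup>2 + e\<^sup>2 / 4"
      by (rule order_tendstoD)
    then obtain N where N: "\<And>n. n \<ge> N \<Longrightarrow> (norm (x - s n))\<^sup>2 < d\<^sup>2 + e\<^sup>2 / 4"
      by (auto simp: eventually_sequentially)
    have "dist (s m) (s n) < e" if "m \<ge> N" "n \<ge> N" for m n
    proof -
      have "(norm (s m - s n))\<^sup>2 < e\<^sup>2"
        using par[OF sS sS, of m n] N[OF that(1)] N[OF that(2)] by (simp add: field_simps)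
      then show ?thesis
        using e by (simp add: dist_norm power2_less_imp_less)
    qed
    then show "\<exists>M. \<forall>m\<ge>M. \<forall>n\<ge>M. dist (s m) (s n) < e" by blast
  qed
  then obtain l where l: "s \<longlonglongrightarrow> l"
    using Cauchy_convergent convergent_def by blast
  have lS: "l \<in> S" using cl sS l closed_sequentially by blast
  have "(\<lambda>n. norm (x - s n)) \<longlonglongrightarrow> norm (x - l)"
    using l by (intro tendsto_intros)
  then have dl: "norm (x - l) = d" using lim LIMSEQ_unique by blast
  have "inner (x - l) y = 0" if y: "y \<in> S" for y
  proof (cases "y = 0")
    case False
    \<comment> \<open>The step \<open>t\<close> is the one minimizing the distance along \<open>y\<close>.\<close>
    define t where "t = inner (x - l) y / inner y y"
    have yy: "inner y y > 0" using False by simp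
    have "l + t *\<^sub>R y \<in> S" using lS y sub by (simp add: subspace_add subspace_scale)
    then have "(norm (x - l))\<^sup>2 \<le> (norm (x - (l + t *\<^sub>R y)))\<^sup>2"
      using dle dl d0 by (simp add: power_mono)
    also have "\<dots> = (norm (x - l))\<^sup>2 - 2 * t * inner (x - l) y + t\<^sup>2 * inner y y"
      unfolding power2_norm_eq_inner
      by (simp add: inner_diff_left inner_diff_right inner_add_left inner_add_right
          inner_commute algebra_simps power2_eq_square)
    also have "\<dots> = (norm (x - l))\<^sup>2 - (inner (x - l) y)\<^sup>2 / inner y y"
      using yy by (simp add: t_def field_simps power2_eq_square)
    finally have "(inner (x - l) y)\<^sup>2 / inner y y \<le> 0" by simp
    then have "(inner (x - l) y)\<^sup>2 \<le> 0" using yy by (simp add: divide_le_0_iff)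
    then show ?thesis by simp
  qed simp
  with lS that show thesis by blast
qed

section \<open>Adjoints and resolvents of symmetric operators\<close>

lemma op_adjoint_iff:
  "(g, k) \<in> op_adjoint T \<longleftrightarrow> (\<forall>f h. (f, h) \<in> T \<longrightarrow> cinner h g = cinner f k)"
  by (auto simp: op_adjoint_def)

lemma op_adjointD: "(g, k) \<in> op_adjoint T \<Longrightarrow> (f, h) \<in> T \<Longrightarrow> cinner h g = cinner f k"
  by (auto simp: op_adjoint_def)

lemma op_adjoint_add:
  "(f, h) \<in> op_adjoint T \<Longrightarrow> (f', h') \<in> op_adjoint T \<Longrightarrow> (f + f', h + h') \<in> op_adjoint T"
  by (simp add: op_adjoint_iff cinner_linear)

lemma op_adjoint_diff:
  "(f, h) \<in> op_adjoint T \<Longrightarrow> (f', h') \<in> op_adjoint T \<Longrightarrow> (f - f', h - h') \<in> op_adjoint T"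
  by (simp add: op_adjoint_iff cinner_linear)

lemma op_adjoint_scaleC: "(f, h) \<in> op_adjoint T \<Longrightarrow> (c *\<^sub>C f, c *\<^sub>C h) \<in> op_adjoint T"
  by (simp add: op_adjoint_iff cinner_linear)

lemma op_adjoint_antimono: "S \<subseteq> T \<Longrightarrow> op_adjoint T \<subseteq> op_adjoint S"
  by (auto simp: op_adjoint_def)

lemma single_valued_op_adjoint:
  assumes "densely_defined T"
  shows "single_valued (op_adjoint T)"
proof (rule single_valuedI)
  fix f h h' assume *: "(f, h) \<in> op_adjoint T" "(f, h') \<in> op_adjoint T"
  have "cinner u (h - h') = 0" if "(u, v) \<in> T" for u v
    using op_adjointD[OF *(1) that] op_adjointD[OF *(2) that] by (simp add: cinner_linear)
  then have "Domain T \<subseteq> {u. inner u (h - h') = 0}"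
    by (auto simp: inner_eq_Re_cinner)
  moreover have "closed {u. inner u (h - h') = 0}"
    by (intro closed_Collect_eq continuous_intros)
  ultimately have "closure (Domain T) \<subseteq> {u. inner u (h - h') = 0}"
    by (rule closure_minimal)
  then have "inner (h - h') (h - h') = 0"
    using assms unfolding densely_defined_def by blast
  then show "h = h'" by simp
qed

lemma op_apply_eq: "single_valued T \<Longrightarrow> (f, h) \<in> T \<Longrightarrow> op_apply T f = h"
  unfolding op_apply_def by (rule the_equality) (auto dest: single_valuedD)

lemma linear_operator_add:
  "linear_operator T \<Longrightarrow> (f, h) \<in> T \<Longrightarrow> (f', h') \<in> T \<Longrightarrow> (f + f', h + h') \<in> T"
  by (auto simp: linear_operator_def)

lemma linear_operator_scaleC:
  "linear_operator T \<Longrightarrow> (f, h) \<in> T \<Longrightarrow> (c *\<^sub>C f, c *\<^sub>C h) \<in> T"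
  by (auto simp: linear_operator_def)

lemma linear_operator_diff:
  assumes "linear_operator T" "(f, h) \<in> T" "(f', h') \<in> T"
  shows "(f - f', h - h') \<in> T"
proof -
  have "(f + (- 1) *\<^sub>C f', h + (- 1) *\<^sub>C h') \<in> T"
    using assms linear_operator_add linear_operator_scaleC by blast
  then show ?thesis by simp
qed

lemma symmetric_subset_op_adjoint: "symmetric_operator T \<Longrightarrow> T \<subseteq> op_adjoint T"
  by (auto simp: symmetric_operator_def op_adjoint_def)

lemma symmetric_Im_cinner:
  assumes "symmetric_operator T" "(u, v) \<in> T"
  shows "Im (cinner v u) = 0"
proof -
  have "cinner v u = cnj (cinner v u)"
    using assms cinner_commute[of u v] by (fastforce simp: symmetric_operator_def)
  then show ?thesis by (metis cnj.simps(2) equal_neg_zero)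
qed

text \<open>
  Only the imaginary part of \<open>w\<close> contributes to the imaginary part of \<open>((T - w)u, u)\<close>, because
  \<open>(Tu, u)\<close> is real.
\<close>

lemma symmetric_lower_bound:
  assumes "symmetric_operator T" "(u, v) \<in> T"
  shows "\<bar>Im w\<bar> * norm u \<le> norm (v - w *\<^sub>C u)"
proof (cases "u = 0")
  case False
  have "Im (cinner (v - w *\<^sub>C u) u) = - Im w * (norm u)\<^sup>2"
    using symmetric_Im_cinner[OF assms] by (simp add: cinner_linear cinner_self)
  then have "\<bar>Im w\<bar> * (norm u)\<^sup>2 = \<bar>inner (v - w *\<^sub>C u) (\<i> *\<^sub>C u)\<bar>"
    by (simp add: Im_cinner[symmetric] abs_mult)
  also have "\<dots> \<le> norm (v - w *\<^sub>C u) * norm u"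
    using Cauchy_Schwarz_ineq2[of "v - w *\<^sub>C u" "\<i> *\<^sub>C u"] by (simp add: norm_imaginary_scaleC)
  finally show ?thesis using False by (simp add: power2_eq_square)
qed simp

lemma tendsto_scaleC:
  assumes "f \<longlonglongrightarrow> (l::'a::complex_inner)"
  shows "(\<lambda>n. w *\<^sub>C f n) \<longlonglongrightarrow> w *\<^sub>C l"
proof -
  have *: "w *\<^sub>C y = Re w *\<^sub>R y + Im w *\<^sub>R (\<i> *\<^sub>C y)" for y :: 'a
    by (simp add: scaleR_scaleC scaleC_scaleC flip: scaleC_add_left)
      (metis complex_eq mult.commute)
  have "(\<lambda>n. \<i> *\<^sub>C f n) \<longlonglongrightarrow> \<i> *\<^sub>C l"
  proof (rule Lim_null[THEN iffD2])
    have "(\<lambda>n. norm (f n - l)) \<longlonglongrightarrow> 0"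
      using assms by (simp add: LIM_zero tendsto_norm_zero)
    then have "(\<lambda>n. norm (\<i> *\<^sub>C f n - \<i> *\<^sub>C l)) \<longlonglongrightarrow> 0"
      by (simp add: norm_imaginary_scaleC flip: cvec.scale_right_diff_distrib)
    then show "(\<lambda>n. \<i> *\<^sub>C f n - \<i> *\<^sub>C l) \<longlonglongrightarrow> 0"
      by (rule tendsto_norm_zero_cancel)
  qed
  with assms show ?thesis
    unfolding * by (intro tendsto_intros)
qed

text \<open>
  By the lower bound, convergence of \<open>(T - w) u\<^sub>n\<close> forces convergence of \<open>u\<^sub>n\<close>, and then of
  \<open>T u\<^sub>n\<close>; closedness of the graph identifies the limits.
\<close>

lemma closed_range_symmetric:
  fixes T :: "('a::complex_hilbert_space \<times> 'a) set"
  assumes sym: "symmetric_operator T" and cl: "closed T" and w: "Im w \<noteq> 0"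
  shows "closed {v - w *\<^sub>C u | u v. (u, v) \<in> T}"
  unfolding closed_sequential_limits
proof (intro allI impI, elim conjE)
  fix y l
  assume "\<forall>n. y n \<in> {v - w *\<^sub>C u | u v. (u, v) \<in> T}" and l: "y \<longlonglongrightarrow> l"
  then obtain u v where uv: "\<And>n. (u n, v n) \<in> T" and y: "\<And>n. y n = v n - w *\<^sub>C u n"
    by simp metis
  have lin: "linear_operator T" using sym by (simp add: symmetric_operator_def)
  have bound: "\<bar>Im w\<bar> * norm (u m - u n) \<le> norm (y m - y n)" for m n
    using symmetric_lower_bound[OF sym linear_operator_diff[OF lin uv uv], of w m n]
    by (simp add: y scaleC_distribs algebra_simps)
  have "Cauchy u"
  proof (rule metric_CauchyI)
    fix e :: real assume "e > 0"
    then have "\<bar>Im w\<bar> * e > 0" using w by simp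
    moreover have "Cauchy y" using l LIMSEQ_imp_Cauchy by blast
    ultimately obtain N where "\<forall>m\<ge>N. \<forall>n\<ge>N. dist (y m) (y n) < \<bar>Im w\<bar> * e"
      using metric_CauchyD by blast
    then have "\<forall>m\<ge>N. \<forall>n\<ge>N. \<bar>Im w\<bar> * norm (u m - u n) < \<bar>Im w\<bar> * e"
      using bound by (metis dist_norm le_less_trans)
    then have "\<forall>m\<ge>N. \<forall>n\<ge>N. dist (u m) (u n) < e"
      using w by (simp add: dist_norm)
    then show "\<exists>N. \<forall>m\<ge>N. \<forall>n\<ge>N. dist (u m) (u n) < e" by blast
  qed
  then obtain a where a: "u \<longlonglongrightarrow> a"
    using Cauchy_convergent convergent_def by blast
  have "v = (\<lambda>n. y n + w *\<^sub>C u n)" by (simp add: y)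
  then have "v \<longlonglongrightarrow> l + w *\<^sub>C a"
    using tendsto_add[OF l tendsto_scaleC[OF a]] by simp
  then have "(\<lambda>n. (u n, v n)) \<longlonglongrightarrow> (a, l + w *\<^sub>C a)"
    using a by (intro tendsto_Pair)
  then have "(a, l + w *\<^sub>C a) \<in> T"
    using closed_sequentially[OF cl, of "\<lambda>n. (u n, v n)"] uv by blast
  moreover have "l = (l + w *\<^sub>C a) - w *\<^sub>C a" by simp
  ultimately show "l \<in> {v - w *\<^sub>C u | u v. (u, v) \<in> T}" by blast
qed

text \<open>
  The orthogonal complement of the range of \<open>T - w\<close> is \<open>Ker (T* - cnj w)\<close>, and the range is
  closed, so the two together fill the space.
\<close>

lemma range_plus_eigenspace:
  fixes T :: "('a::complex_hilbert_space \<times> 'a) set"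
  assumes sym: "symmetric_operator T" and cl: "closed T" and w: "Im w \<noteq> 0"
  obtains u v q where "(u, v) \<in> T" "(q, cnj w *\<^sub>C q) \<in> op_adjoint T" "y = v - w *\<^sub>C u + q"
proof -
  let ?R = "{v - w *\<^sub>C u | u v. (u, v) \<in> T}"
  have lin: "linear_operator T" using sym by (simp add: symmetric_operator_def)
  have scale: "c *\<^sub>C r \<in> ?R" if "r \<in> ?R" for c r
  proof -
    obtain u v where "(u, v) \<in> T" "r = v - w *\<^sub>C u" using \<open>r \<in> ?R\<close> by blast
    then have "(c *\<^sub>C u, c *\<^sub>C v) \<in> T" "c *\<^sub>C r = c *\<^sub>C v - w *\<^sub>C (c *\<^sub>C u)"
      using linear_operator_scaleC[OF lin] by (auto simp: scaleC_distribs mult.commute)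
    then show ?thesis by blast
  qed
  have "subspace ?R"
  proof (rule subspaceI)
    show "0 \<in> ?R"
    proof -
      have "(0, 0) \<in> T" "0 = 0 - w *\<^sub>C 0" using lin by (simp_all add: linear_operator_def)
      then show ?thesis by blast
    qed
    fix r r' assume "r \<in> ?R" "r' \<in> ?R"
    then obtain u v u' v' where "(u, v) \<in> T" "r = v - w *\<^sub>C u" "(u', v') \<in> T" "r' = v' - w *\<^sub>C u'"
      by blast
    then have "r + r' = v + v' - w *\<^sub>C (u + u')" by (simp add: cvec.scale_right_distrib)
    moreover have "(u + u', v + v') \<in> T"
      using linear_operator_add[OF lin] \<open>(u, v) \<in> T\<close> \<open>(u', v') \<in> T\<close> by blast
    ultimately show "r + r' \<in> ?R" by blast
  qed (use scale in \<open>simp add: scaleR_scaleC\<close>)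
  then obtain r where r: "r \<in> ?R" and orth: "\<And>r'. r' \<in> ?R \<Longrightarrow> inner (y - r) r' = 0"
    using orthogonal_projection_exists[OF _ closed_range_symmetric[OF sym cl w]] by blast
  obtain u v where uv: "(u, v) \<in> T" "r = v - w *\<^sub>C u" using r by auto
  have "cinner v' (y - r) = cinner u' (cnj w *\<^sub>C (y - r))" if "(u', v') \<in> T" for u' v'
  proof -
    have "v' - w *\<^sub>C u' \<in> ?R" using that by blast
    then have "cinner (y - r) (v' - w *\<^sub>C u') = 0"
      using orth scale by (intro cinner_eq_zero_of_inner) blast+
    then have "cinner (v' - w *\<^sub>C u') (y - r) = 0"
      by (metis cinner_commute complex_cnj_zero)
    then show ?thesis by (simp add: cinner_diff_left cinner_scaleC_left cinner_scaleC_right)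
  qed
  then have "(y - r, cnj w *\<^sub>C (y - r)) \<in> op_adjoint T"
    by (simp add: op_adjoint_iff)
  moreover have "y = v - w *\<^sub>C u + (y - r)" using uv by simp
  ultimately show thesis using that uv by blast
qed

text \<open>
  On \<open>Ker (T* - cnj w)\<close> the operator \<open>T* - w\<close> is multiplication by the nonzero number
  \<open>cnj w - w\<close>, which takes care of the component outside the range of \<open>T - w\<close>.
\<close>

lemma op_adjoint_minus_surj:
  fixes T :: "('a::complex_hilbert_space \<times> 'a) set"
  assumes sym: "symmetric_operator T" and cl: "closed T" and w: "Im w \<noteq> 0"
  obtains f where "(f, y + w *\<^sub>C f) \<in> op_adjoint T"
proof -
  obtain u v q where uv: "(u, v) \<in> T" and q: "(q, cnj w *\<^sub>C q) \<in> op_adjoint T"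
    and y: "y = v - w *\<^sub>C u + q"
    using range_plus_eigenspace[OF assms] by metis
  define c where "c = 1 / (cnj w - w)"
  have "cnj w - w \<noteq> 0" using w by (simp add: complex_eq_iff)
  then have c: "c * cnj w = 1 + w * c" by (simp add: c_def field_simps)
  have "(u, v) \<in> op_adjoint T" using symmetric_subset_op_adjoint[OF sym] uv by blast
  then have "(u + c *\<^sub>C q, v + c *\<^sub>C cnj w *\<^sub>C q) \<in> op_adjoint T"
    using op_adjoint_add op_adjoint_scaleC q by blast
  moreover have "v + c *\<^sub>C cnj w *\<^sub>C q = y + w *\<^sub>C (u + c *\<^sub>C q)"
    by (simp add: y c scaleC_distribs)
  ultimately show thesis using that by metis
qed

text \<open>
  Adding \<open>c(u, v)\<close> with \<open>(u, v)\<close> in the graph of \<open>S\<close> changes \<open>Im (Tf, f)\<close> by an expression that is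
  real-linear in \<open>c\<close>, since \<open>(Su, u)\<close> is real. It is bounded below, hence zero.
\<close>

lemma dissipative_extension_subset_op_adjoint:
  assumes sym: "symmetric_operator S" and ST: "S \<subseteq> T" and diss: "dissipative_operator T"
  shows "T \<subseteq> op_adjoint S"
proof (clarsimp simp: op_adjoint_iff)
  fix f h u v assume fh: "(f, h) \<in> T" and uv: "(u, v) \<in> S"
  have lin: "linear_operator T" and pos: "\<And>f h. (f, h) \<in> T \<Longrightarrow> 0 \<le> Im (cinner h f)"
    using diss by (auto simp: dissipative_operator_def)
  define d where "d = cinner v f - cinner u h"
  have real: "Im (cinner v u) = 0" using symmetric_Im_cinner[OF sym uv] .
  have ineq: "0 \<le> Im (cinner h f) + Im (c * d)" for c
  proof -
    have "(f + c *\<^sub>C u, h + c *\<^sub>C v) \<in> T"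
      using lin fh uv ST linear_operator_add linear_operator_scaleC by blast
    then have "0 \<le> Im (cinner (h + c *\<^sub>C v) (f + c *\<^sub>C u))" by (rule pos)
    also have "cinner (h + c *\<^sub>C v) (f + c *\<^sub>C u)
        = cinner h f + c * cinner v f + cnj (c * cinner u h) + c * cnj c * cinner v u"
      by (simp add: cinner_linear algebra_simps) (metis cinner_commute)
    also have "Im (c * cnj c * cinner v u) = 0"
      using real by (simp add: complex_norm_square[symmetric])
    ultimately show ?thesis
      using real by (simp add: d_def algebra_simps)
  qed
  \<comment> \<open>If \<open>d \<noteq> 0\<close>, then \<open>c\<close> can be chosen with \<open>Im (c * d) < - Im (h, f)\<close>.\<close>
  have "d = 0"
  proof (rule ccontr)
    assume "d \<noteq> 0"
    then have "- \<i> * of_real (Im (cinner h f) + 1) / d * d = - \<i> * of_real (Im (cinner h f) + 1)"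
      by simp
    then show False using ineq[of "- \<i> * of_real (Im (cinner h f) + 1) / d"] by simp
  qed
  then show "cinner v f = cinner u h" by (simp add: d_def)
qed

lemma eigenspace_spanned:
  assumes dim: "cvec.dim (eigenspace_op T z) = 1" and "p \<in> eigenspace_op T z" "p \<noteq> 0"
    and "f \<in> eigenspace_op T z"
  obtains c where "f = c *\<^sub>C p"
proof -
  obtain B where B: "eigenspace_op T z \<subseteq> cvec.span B" "card B = 1"
    using cvec.basis_exists[of "eigenspace_op T z"] dim by metis
  then obtain b where "B = {b}" using card_1_singletonE by blast
  then have "p \<in> range (\<lambda>k. k *\<^sub>C b)" "f \<in> range (\<lambda>k. k *\<^sub>C b)"
    using B(1) assms(2,4) by (auto simp: cvec.span_singleton)
  then obtain c d where "p = c *\<^sub>C b" "f = d *\<^sub>C b" by blast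
  moreover from this have "c \<noteq> 0" using \<open>p \<noteq> 0\<close> by auto
  ultimately have "f = (d / c) *\<^sub>C p" by simp
  then show thesis using that by blast
qed

section \<open>Boundary values for deficiency indices (1, 1)\<close>

locale deficiency_one =
  fixes T :: "('a::complex_hilbert_space \<times> 'a) set" and gp gm :: 'a
  assumes sym: "symmetric_operator T" and closed: "closed T" and dense: "densely_defined T"
    and gp: "(gp, \<i> *\<^sub>C gp) \<in> op_adjoint T" and gm: "(gm, (- \<i>) *\<^sub>C gm) \<in> op_adjoint T"
    and norm_gp: "norm gp = 1" and norm_gm: "norm gm = 1"
    and gp_spans: "(f, \<i> *\<^sub>C f) \<in> op_adjoint T \<Longrightarrow> \<exists>c. f = c *\<^sub>C gp"
    and gm_spans: "(f, (- \<i>) *\<^sub>C f) \<in> op_adjoint T \<Longrightarrow> \<exists>c. f = c *\<^sub>C gm"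
begin

text \<open>
  These are the coefficients of \<open>g\<^sub>+\<close> and \<open>g\<^sub>-\<close> in von Neumann's decomposition of \<open>f \<in> Dom T*\<close>,
  where \<open>h = T* f\<close>. The formulas pair \<open>(f, h)\<close> with \<open>g\<^sub>+\<close> and \<open>g\<^sub>-\<close> in the form
  \<open>(T* f, f') - (f, T* f')\<close>, which vanishes on \<open>Dom T\<close>.
\<close>

definition coef_plus :: "'a \<Rightarrow> 'a \<Rightarrow> complex" where
  "coef_plus f h = cinner (h + \<i> *\<^sub>C f) gp / (2 * \<i>)"

definition coef_minus :: "'a \<Rightarrow> 'a \<Rightarrow> complex" where
  "coef_minus f h = - (cinner (h - \<i> *\<^sub>C f) gm / (2 * \<i>))"

lemma coef_plus_linear:
  "coef_plus (f + f') (h + h') = coef_plus f h + coef_plus f' h'"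
  "coef_plus (f - f') (h - h') = coef_plus f h - coef_plus f' h'"
  "coef_plus (c *\<^sub>C f) (c *\<^sub>C h) = c * coef_plus f h"
  by (simp_all add: coef_plus_def cinner_linear field_simps)

lemma coef_minus_linear:
  "coef_minus (f + f') (h + h') = coef_minus f h + coef_minus f' h'"
  "coef_minus (f - f') (h - h') = coef_minus f h - coef_minus f' h'"
  "coef_minus (c *\<^sub>C f) (c *\<^sub>C h) = c * coef_minus f h"
  by (simp_all add: coef_minus_def cinner_linear field_simps)

lemma coefs_gp: "coef_plus gp (\<i> *\<^sub>C gp) = 1" "coef_minus gp (\<i> *\<^sub>C gp) = 0"
  by (simp_all add: coef_plus_def coef_minus_def cinner_linear cinner_self norm_gp)

lemma coefs_gm: "coef_plus gm ((- \<i>) *\<^sub>C gm) = 0" "coef_minus gm ((- \<i>) *\<^sub>C gm) = 1"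
  by (simp_all add: coef_plus_def coef_minus_def cinner_linear cinner_self norm_gm flip: cvec.scale_minus_left)

lemma T_subset: "T \<subseteq> op_adjoint T"
  using symmetric_subset_op_adjoint[OF sym] .

lemma coefs_T:
  assumes "(u, v) \<in> T"
  shows "coef_plus u v = 0" "coef_minus u v = 0"
  using op_adjointD[OF gp assms] op_adjointD[OF gm assms]
  by (simp_all add: coef_plus_def coef_minus_def cinner_linear del: cvec.scale_minus_left)

text \<open>
  Splitting \<open>h + \<i>f\<close> into the range of \<open>T + \<i>\<close> and its complement \<open>Ker (T* - \<i>)\<close> removes the
  components in \<open>Dom T\<close> and along \<open>g\<^sub>+\<close>; what remains is annihilated by \<open>T* + \<i>\<close>.
\<close>

lemma von_Neumann_decomposition:
  assumes fh: "(f, h) \<in> op_adjoint T"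
  obtains u v where "(u, v) \<in> T" "f = u + coef_plus f h *\<^sub>C gp + coef_minus f h *\<^sub>C gm"
    "h = v + (coef_plus f h * \<i>) *\<^sub>C gp + (coef_minus f h * - \<i>) *\<^sub>C gm"
proof -
  obtain u v q where uv: "(u, v) \<in> T" and q: "(q, cnj (- \<i>) *\<^sub>C q) \<in> op_adjoint T"
    and eq: "h + \<i> *\<^sub>C f = v - (- \<i>) *\<^sub>C u + q"
    using range_plus_eigenspace[OF sym closed, of "- \<i>" "h + \<i> *\<^sub>C f"] by auto
  from q obtain c where c: "q = c *\<^sub>C gp"
    using gp_spans by auto
  define a where "a = c / (2 * \<i>)"
  have q2: "q = (2 * \<i> * a) *\<^sub>C gp" by (simp add: c a_def)
  define f' where "f' = f - u - a *\<^sub>C gp"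
  define h' where "h' = h - v - (a * \<i>) *\<^sub>C gp"
  have "(a *\<^sub>C gp, (a * \<i>) *\<^sub>C gp) \<in> op_adjoint T"
    using op_adjoint_scaleC[OF gp, of a] by simp
  then have f'h': "(f', h') \<in> op_adjoint T"
    unfolding f'_def h'_def using fh uv T_subset by (intro op_adjoint_diff) auto
  have "h' + \<i> *\<^sub>C f' = (h + \<i> *\<^sub>C f) - (v + \<i> *\<^sub>C u) - (2 * \<i> * a) *\<^sub>C gp"
    by (simp add: f'_def h'_def scaleC_distribs algebra_simps)
      (simp flip: cvec.scale_left_distrib)
  also have "\<dots> = 0" by (simp add: eq q2)
  finally have h': "h' = (- \<i>) *\<^sub>C f'" by (simp add: add_eq_0_iff2)
  then obtain b where b: "f' = b *\<^sub>C gm" using gm_spans f'h' by metis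
  have f: "f = u + a *\<^sub>C gp + b *\<^sub>C gm"
    using b by (simp add: f'_def algebra_simps)
  have h: "h = v + a *\<^sub>C \<i> *\<^sub>C gp + b *\<^sub>C (- \<i>) *\<^sub>C gm"
    using h' b by (simp add: h'_def algebra_simps)
  have ab: "coef_plus f h = a" "coef_minus f h = b"
    by (simp_all only: f h coef_plus_linear coef_minus_linear coefs_T[OF uv] coefs_gp coefs_gm) simp_all
  show thesis
    using that[OF uv] f h unfolding ab by (simp only: scaleC_scaleC)
qed

text \<open>
  When \<open>f'\<close> is expanded by von Neumann's decomposition, the \<open>Dom T\<close> part drops out, and the other
  two parts produce the coefficients of \<open>f\<close> by their very definition.
\<close>

lemma Green_identity:
  assumes fh: "(f, h) \<in> op_adjoint T" and fh': "(f', h') \<in> op_adjoint T"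
  shows "cinner h f' - cinner f h'
    = 2 * \<i> * (coef_plus f h * cnj (coef_plus f' h') - coef_minus f h * cnj (coef_minus f' h'))"
proof -
  define a b where "a = coef_plus f' h'" and "b = coef_minus f' h'"
  obtain u v where uv: "(u, v) \<in> T" and f': "f' = u + a *\<^sub>C gp + b *\<^sub>C gm"
    and h': "h' = v + (a * \<i>) *\<^sub>C gp + (b * - \<i>) *\<^sub>C gm"
    using von_Neumann_decomposition[OF fh'] unfolding a_def b_def .
  have 1: "cinner h u = cinner f v"
    using op_adjointD[OF fh uv] cinner_commute[of h u] cinner_commute[of f v] by simp
  have "cinner h f' - cinner f h'
      = cnj a * cinner (h + \<i> *\<^sub>C f) gp + cnj b * cinner (h - \<i> *\<^sub>C f) gm"
    unfolding f' h' using 1 by (simp add: cinner_linear algebra_simps del: cvec.scale_minus_left)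
  also have "\<dots> = 2 * \<i> * (coef_plus f h * cnj a - coef_minus f h * cnj b)"
    by (simp add: coef_plus_def coef_minus_def field_simps)
  finally show ?thesis by (simp add: a_def b_def)
qed

lemma Im_cinner_coefs:
  assumes "(f, h) \<in> op_adjoint T"
  shows "Im (cinner h f) = (cmod (coef_plus f h))\<^sup>2 - (cmod (coef_minus f h))\<^sup>2"
proof -
  have "cinner h f - cnj (cinner h f)
      = 2 * \<i> * of_real ((cmod (coef_plus f h))\<^sup>2 - (cmod (coef_minus f h))\<^sup>2)"
    using Green_identity[OF assms assms]
    by (simp add: complex_norm_square[symmetric] flip: cinner_commute)
  from arg_cong[OF this, of Im] show ?thesis by simp
qed

lemma eigenvector_norm_coefs:
  assumes "(f, z *\<^sub>C f) \<in> op_adjoint T"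
  shows "Im z * (norm f)\<^sup>2 = (cmod (coef_plus f (z *\<^sub>C f)))\<^sup>2 - (cmod (coef_minus f (z *\<^sub>C f)))\<^sup>2"
  using Im_cinner_coefs[OF assms] by (simp add: cinner_scaleC_left cinner_self)

text \<open>
  The combination of \<open>f\<close> and \<open>k\<close> with vanishing \<open>g\<^sub>+\<close> coefficient lies in \<open>Ker (T* - z)\<close>, and
  \<open>Im z\<close> times its squared norm is minus the squared modulus of its \<open>g\<^sub>-\<close> coefficient, which must
  therefore vanish as well.
\<close>

lemma eigenvector_coef_ratio:
  assumes z: "Im z > 0" and f: "(f, z *\<^sub>C f) \<in> op_adjoint T" and k: "(k, z *\<^sub>C k) \<in> op_adjoint T"
  shows "coef_plus k (z *\<^sub>C k) * coef_minus f (z *\<^sub>C f) = coef_plus f (z *\<^sub>C f) * coef_minus k (z *\<^sub>C k)"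
proof -
  define a b where "a = coef_plus f (z *\<^sub>C f)" and "b = coef_plus k (z *\<^sub>C k)"
  define x where "x = b *\<^sub>C f - a *\<^sub>C k"
  have zx: "z *\<^sub>C x = b *\<^sub>C z *\<^sub>C f - a *\<^sub>C z *\<^sub>C k"
    by (simp add: x_def scaleC_distribs mult.commute)
  have x: "(x, z *\<^sub>C x) \<in> op_adjoint T"
    unfolding zx unfolding x_def using f k by (intro op_adjoint_diff op_adjoint_scaleC)
  have "coef_plus x (z *\<^sub>C x) = 0"
    unfolding zx unfolding x_def coef_plus_linear by (simp add: a_def b_def)
  moreover have "0 \<le> Im z * (norm x)\<^sup>2" using z by simp
  ultimately have "coef_minus x (z *\<^sub>C x) = 0"
    using eigenvector_norm_coefs[OF x] by simp
  then show ?thesis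
    unfolding zx unfolding x_def coef_minus_linear by (simp add: a_def b_def)
qed

section \<open>Maximal dissipative extensions\<close>

text \<open>
  The restriction of \<open>T*\<close> to \<open>Dom T + span (g\<^sub>+ - \<kappa> g\<^sub>-)\<close>, described by a boundary condition
  instead of by its domain.
\<close>

definition extension :: "complex \<Rightarrow> ('a \<times> 'a) set" where
  "extension \<kappa> = {(f, h) \<in> op_adjoint T. coef_minus f h = - \<kappa> * coef_plus f h}"

lemma single_valued_adjoint: "single_valued (op_adjoint T)"
  using single_valued_op_adjoint[OF dense] .

lemma T_subset_extension: "T \<subseteq> extension \<kappa>"
  using T_subset coefs_T by (auto simp: extension_def)

lemma dissipative_extension:
  assumes "cmod \<kappa> \<le> 1"
  shows "dissipative_operator (extension \<kappa>)"
  unfolding dissipative_operator_def linear_operator_def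
proof (intro conjI allI impI)
  show "single_valued (extension \<kappa>)"
    using single_valued_adjoint by (rule single_valued_subset[rotated]) (auto simp: extension_def)
  show "(0, 0) \<in> extension \<kappa>"
    using T_subset_extension sym by (auto simp: symmetric_operator_def linear_operator_def)
next
  fix f h f' h' assume "(f, h) \<in> extension \<kappa> \<and> (f', h') \<in> extension \<kappa>"
  then show "(f + f', h + h') \<in> extension \<kappa>"
    by (auto simp: extension_def coef_plus_linear coef_minus_linear op_adjoint_add algebra_simps)
next
  fix c f h assume "(f, h) \<in> extension \<kappa>"
  then show "(c *\<^sub>C f, c *\<^sub>C h) \<in> extension \<kappa>"
    by (auto simp: extension_def coef_plus_linear coef_minus_linear op_adjoint_scaleC)
next
  show "\<forall>(f, h)\<in>extension \<kappa>. 0 \<le> Im (cinner h f)"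
  proof clarify
    fix f h assume "(f, h) \<in> extension \<kappa>"
    then have "(f, h) \<in> op_adjoint T" and eq: "coef_minus f h = - \<kappa> * coef_plus f h"
      by (auto simp: extension_def)
    then have "Im (cinner h f) = (cmod (coef_plus f h))\<^sup>2 - (cmod \<kappa> * cmod (coef_plus f h))\<^sup>2"
      by (simp add: Im_cinner_coefs norm_mult)
    moreover have "(cmod \<kappa> * cmod (coef_plus f h))\<^sup>2 \<le> (cmod (coef_plus f h))\<^sup>2"
      using assms by (intro power_mono) (auto simp: mult_left_le_one_le)
    ultimately show "0 \<le> Im (cinner h f)" by simp
  qed
qed

text \<open>
  One inclusion is Green's identity against the single vector \<open>g\<^sub>+ - \<kappa> g\<^sub>-\<close>, which has coefficients
  \<open>1\<close> and \<open>-\<kappa>\<close>; for the other one, the two boundary conditions cancel the right-hand side of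
  Green's identity.
\<close>

lemma op_adjoint_extension:
  "op_adjoint (extension \<kappa>) = {(f, h) \<in> op_adjoint T. coef_plus f h = - cnj \<kappa> * coef_minus f h}"
proof (intro set_eqI iffI; clarify)
  fix f h assume fh: "(f, h) \<in> op_adjoint (extension \<kappa>)"
  then have fhT: "(f, h) \<in> op_adjoint T"
    using op_adjoint_antimono[OF T_subset_extension] by blast
  define x y where "x = gp - \<kappa> *\<^sub>C gm" and "y = \<i> *\<^sub>C gp - \<kappa> *\<^sub>C (- \<i>) *\<^sub>C gm"
  have "(x, y) \<in> op_adjoint T"
    unfolding x_def y_def by (intro op_adjoint_diff op_adjoint_scaleC gp gm)
  moreover have "coef_plus x y = 1" "coef_minus x y = - \<kappa>"
    unfolding x_def y_def coef_plus_linear coef_minus_linear coefs_gp coefs_gm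
    by simp_all
  ultimately have xy: "(x, y) \<in> op_adjoint T" "coef_plus x y = 1" "coef_minus x y = - \<kappa>" by blast+
  then have "(x, y) \<in> extension \<kappa>" by (simp add: extension_def)
  then have "cinner y f - cinner x h = 0" using op_adjointD[OF fh] by simp
  then have "cnj (coef_plus f h) + \<kappa> * cnj (coef_minus f h) = 0"
    using Green_identity[OF xy(1) fhT] xy by simp
  then have "cnj (cnj (coef_plus f h) + \<kappa> * cnj (coef_minus f h)) = 0" by simp
  then have "coef_plus f h = - cnj \<kappa> * coef_minus f h" by (simp add: add_eq_0_iff2)
  with fhT show "(f, h) \<in> op_adjoint T \<and> coef_plus f h = - cnj \<kappa> * coef_minus f h" by simp
next
  fix f h assume fh: "(f, h) \<in> op_adjoint T" and eq: "coef_plus f h = - cnj \<kappa> * coef_minus f h"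
  show "(f, h) \<in> op_adjoint (extension \<kappa>)"
    unfolding op_adjoint_iff
  proof (intro allI impI)
    fix x y assume "(x, y) \<in> extension \<kappa>"
    then have "(x, y) \<in> op_adjoint T" "coef_minus x y = - \<kappa> * coef_plus x y"
      by (auto simp: extension_def)
    then show "cinner y f = cinner x h"
      using Green_identity[OF _ fh, of x y] eq by simp
  qed
qed

text \<open>
  Dissipativity forces an element with zero \<open>g\<^sub>+\<close> coefficient to have zero \<open>g\<^sub>-\<close> coefficient too.
  Hence the ratio of the coefficients is constant on a dissipative extension, which is therefore
  contained in some \<^const>\<open>extension\<close>; maximality gives equality.
\<close>

lemma maximal_dissipative_eq_extension:
  assumes max: "maximal_dissipative_extension T B"
  obtains \<kappa> where "cmod \<kappa> \<le> 1" "B = extension \<kappa>"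
proof -
  have TB: "T \<subseteq> B" and diss: "dissipative_operator B"
    and maxi: "\<And>B'. dissipative_operator B' \<Longrightarrow> B \<subseteq> B' \<Longrightarrow> B' = B"
    using max by (auto simp: maximal_dissipative_extension_def)
  have lin: "linear_operator B" using diss by (simp add: dissipative_operator_def)
  have sub: "B \<subseteq> op_adjoint T"
    using dissipative_extension_subset_op_adjoint[OF sym TB diss] .
  have le: "cmod (coef_minus f h) \<le> cmod (coef_plus f h)" if "(f, h) \<in> B" for f h
  proof -
    have "0 \<le> Im (cinner h f)" using diss that by (auto simp: dissipative_operator_def)
    then show ?thesis
      using Im_cinner_coefs[of f h] that sub by (auto intro: power2_le_imp_le)
  qed
  have "\<exists>\<kappa>. cmod \<kappa> \<le> 1 \<and> B \<subseteq> extension \<kappa>"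
  proof (cases "\<exists>(f, h) \<in> B. coef_plus f h \<noteq> 0")
    case True
    then obtain f0 h0 where B0: "(f0, h0) \<in> B" and n0: "coef_plus f0 h0 \<noteq> 0" by blast
    define \<kappa> where "\<kappa> = - (coef_minus f0 h0 / coef_plus f0 h0)"
    have "cmod \<kappa> \<le> 1"
      using le[OF B0] n0 by (simp add: \<kappa>_def norm_divide)
    moreover have "coef_minus f h = - \<kappa> * coef_plus f h" if fh: "(f, h) \<in> B" for f h
    proof -
      define c where "c = coef_plus f h / coef_plus f0 h0"
      have "(f - c *\<^sub>C f0, h - c *\<^sub>C h0) \<in> B"
        using lin fh B0 linear_operator_diff linear_operator_scaleC by blast
      from le[OF this] have "coef_minus f h - c * coef_minus f0 h0 = 0"
        unfolding coef_plus_linear coef_minus_linear using n0 by (simp add: c_def)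
      then show ?thesis using n0 by (simp add: c_def \<kappa>_def)
    qed
    ultimately show ?thesis using sub by (auto simp: extension_def)
  next
    case False
    then have "B \<subseteq> extension 0"
      using le sub by (fastforce simp: extension_def)
    then show ?thesis by (metis norm_zero zero_le_one)
  qed
  then obtain \<kappa> where "cmod \<kappa> \<le> 1" "B \<subseteq> extension \<kappa>" by blast
  with maxi dissipative_extension that show thesis by metis
qed

lemma extension_self_adjoint:
  assumes "cmod \<kappa> = 1"
  shows "op_adjoint (extension \<kappa>) = extension \<kappa>"
proof -
  have "\<kappa> * cnj \<kappa> = 1" using assms by (simp add: complex_norm_square[symmetric])
  then have "coef_plus f h = - cnj \<kappa> * coef_minus f h \<longleftrightarrow> coef_minus f h = - \<kappa> * coef_plus f h" for f h
    by (metis (no_types, opaque_lifting) minus_mult_left minus_mult_right mult.assoc mult.commute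
        mult_1 minus_minus)
  then show ?thesis unfolding op_adjoint_extension by (simp add: extension_def)
qed

text \<open>
  Since \<open>T*\<close> is single-valued, membership of \<open>g\<^sub>+ - c g\<^sub>-\<close> in the domain is decided by the
  boundary condition at its coefficients \<open>1\<close> and \<open>-c\<close>, which holds for \<open>c = \<kappa>\<close> only.
\<close>

lemma von_neumann_parameter_extension:
  assumes "cmod \<kappa> < 1"
  shows "von_neumann_parameter (extension \<kappa>) gp gm = \<kappa>"
proof -
  have key: "gp - c *\<^sub>C gm \<in> Domain (extension \<kappa>) \<longleftrightarrow> c = \<kappa>" for c
  proof -
    define x y where "x = gp - c *\<^sub>C gm" and "y = \<i> *\<^sub>C gp - c *\<^sub>C (- \<i>) *\<^sub>C gm"
    have "(x, y) \<in> op_adjoint T"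
    unfolding x_def y_def by (intro op_adjoint_diff op_adjoint_scaleC gp gm)
  moreover have "coef_plus x y = 1" "coef_minus x y = - c"
      unfolding x_def y_def coef_plus_linear coef_minus_linear coefs_gp coefs_gm
      by simp_all
  ultimately have xy: "(x, y) \<in> op_adjoint T" "coef_plus x y = 1" "coef_minus x y = - c" by blast+
    have "x \<in> Domain (extension \<kappa>) \<longleftrightarrow> (x, y) \<in> extension \<kappa>"
      using single_valuedD[OF single_valued_adjoint xy(1)] by (auto simp: extension_def)
    also have "\<dots> \<longleftrightarrow> c = \<kappa>" using xy by (simp add: extension_def)
    finally show ?thesis by (simp add: x_def)
  qed
  show ?thesis
    unfolding von_neumann_parameter_def key using assms by (intro the_equality) auto
qed

section \<open>The Livsic and Weyl-Titchmarsh functions in terms of boundary values\<close>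

lemma eigenvector_coefs:
  "2 * \<i> * coef_plus f (z *\<^sub>C f) = (z + \<i>) * cinner f gp"
  "2 * \<i> * coef_minus f (z *\<^sub>C f) = - ((z - \<i>) * cinner f gm)"
  by (simp_all add: coef_plus_def coef_minus_def cinner_linear field_simps)

lemma livsic_function_coefs:
  "livsic_function gp gm g z = - (coef_minus (g z) (z *\<^sub>C g z) / coef_plus (g z) (z *\<^sub>C g z))"
proof -
  have "livsic_function gp gm g z = ((z - \<i>) * cinner (g z) gm) / ((z + \<i>) * cinner (g z) gp)"
    by (simp add: livsic_function_def)
  also have "\<dots> = - (2 * \<i> * coef_minus (g z) (z *\<^sub>C g z)) / (2 * \<i> * coef_plus (g z) (z *\<^sub>C g z))"
    by (simp only: eigenvector_coefs) simp
  finally show ?thesis by simp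
qed

lemma eigenvector_coef_less:
  assumes "Im z > 0" "(f, z *\<^sub>C f) \<in> op_adjoint T" "f \<noteq> 0"
  shows "cmod (coef_minus f (z *\<^sub>C f)) < cmod (coef_plus f (z *\<^sub>C f))"
proof -
  have "0 < Im z * (norm f)\<^sup>2" using assms by simp
  then show ?thesis
    using eigenvector_norm_coefs[OF assms(2)] by (auto intro: power2_less_imp_less)
qed

text \<open>
  The coefficients \<open>a\<close> at \<open>g\<^sub>+\<close> and \<open>b\<close> at \<open>g\<^sub>-\<close> of an eigenvector \<open>e\<close> of \<open>T*\<close> for \<open>z\<close> satisfy
  \<open>|b| < |a|\<close>, whereas the boundary condition
  \<open>a = - cnj \<kappa> b\<close> of the adjoint requires \<open>|a| \<le> |b|\<close>. Hence no eigenvector satisfies it, which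
  makes the solution of the resolvent equation unique, and a suitable multiple of \<open>e\<close> corrects an
  arbitrary solution in \<open>Dom T*\<close> to one that satisfies it.
\<close>

lemma resolvent_adjoint_extension:
  assumes k: "cmod \<kappa> < 1" and z: "Im z > 0"
    and e: "(e, z *\<^sub>C e) \<in> op_adjoint T" "e \<noteq> 0"
  obtains f where "(f, gp + z *\<^sub>C f) \<in> op_adjoint (extension \<kappa>)"
    "op_apply (resolvent_op (op_adjoint (extension \<kappa>)) z) gp = f"
    "op_apply (op_adjoint (extension \<kappa>)) f = gp + z *\<^sub>C f"
proof -
  let ?E = "op_adjoint (extension \<kappa>)"
  obtain f0 where f0: "(f0, gp + z *\<^sub>C f0) \<in> op_adjoint T"
    using op_adjoint_minus_surj[OF sym closed] z by (metis less_irrefl)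
  define a b where "a = coef_plus e (z *\<^sub>C e)" and "b = coef_minus e (z *\<^sub>C e)"
  have "a + cnj \<kappa> * b \<noteq> 0"
  proof
    assume "a + cnj \<kappa> * b = 0"
    then have "cmod a = cmod \<kappa> * cmod b"
      by (metis add_eq_0_iff2 complex_mod_cnj norm_minus_cancel norm_mult)
    also have "\<dots> \<le> cmod b" using k by (simp add: mult_left_le_one_le)
    finally show False using eigenvector_coef_less[OF z e] by (simp add: a_def b_def)
  qed
  define A B where "A = coef_plus f0 (gp + z *\<^sub>C f0)" and "B = coef_minus f0 (gp + z *\<^sub>C f0)"
  \<comment> \<open>Subtracting an eigenvector keeps the equation; \<open>c\<close> enforces the boundary condition.\<close>
  define c where "c = (A + cnj \<kappa> * B) / (a + cnj \<kappa> * b)"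
  define f where "f = f0 - c *\<^sub>C e"
  have zf: "gp + z *\<^sub>C f = (gp + z *\<^sub>C f0) - c *\<^sub>C z *\<^sub>C e"
    by (simp add: f_def scaleC_distribs mult.commute)
  have "c * (a + cnj \<kappa> * b) = A + cnj \<kappa> * B"
    using \<open>a + cnj \<kappa> * b \<noteq> 0\<close> by (simp add: c_def)
  then have "A - c * a = - cnj \<kappa> * (B - c * b)" by algebra
  moreover have "coef_plus f (gp + z *\<^sub>C f) = A - c * a" "coef_minus f (gp + z *\<^sub>C f) = B - c * b"
    unfolding zf unfolding f_def coef_plus_linear coef_minus_linear by (simp_all add: A_def B_def a_def b_def)
  moreover have "(f, gp + z *\<^sub>C f) \<in> op_adjoint T"
    unfolding zf unfolding f_def using f0 e by (intro op_adjoint_diff op_adjoint_scaleC)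
  ultimately have f: "(f, gp + z *\<^sub>C f) \<in> ?E"
    unfolding op_adjoint_extension by simp
  have inj: "x = 0" if x: "(x, z *\<^sub>C x) \<in> ?E" for x
  proof -
    have xT: "(x, z *\<^sub>C x) \<in> op_adjoint T" and eq: "coef_plus x (z *\<^sub>C x) = - cnj \<kappa> * coef_minus x (z *\<^sub>C x)"
      using x by (auto simp: op_adjoint_extension)
    have "cmod (coef_plus x (z *\<^sub>C x)) \<le> cmod (coef_minus x (z *\<^sub>C x))"
      using k by (simp add: eq norm_mult mult_left_le_one_le)
    then show ?thesis using eigenvector_coef_less[OF z xT] by force
  qed
  have "f' = f" if "(f', gp + z *\<^sub>C f') \<in> ?E" for f'
  proof -
    have "(f' - f, z *\<^sub>C (f' - f)) \<in> ?E"
      using op_adjoint_diff[OF that f] by (simp add: scaleC_distribs)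
    then show ?thesis using inj by fastforce
  qed
  then have single_valued_at_gp: "\<And>f'. (gp, f') \<in> resolvent_op ?E z \<Longrightarrow> f' = f"
    by (auto simp: resolvent_op_def)
  have "(gp, f) \<in> resolvent_op ?E z"
    using f by (force simp: resolvent_op_def)
  then have "op_apply (resolvent_op ?E z) gp = f"
    unfolding op_apply_def using single_valued_at_gp by (intro the_equality) blast+
  moreover have "op_apply ?E f = gp + z *\<^sub>C f"
    using f op_adjoint_antimono[OF T_subset_extension]
    by (intro op_apply_eq single_valued_subset[OF _ single_valued_adjoint])
  ultimately show thesis using that f by blast
qed

text \<open>
  If \<open>f\<close> solves the resolvent equation with right-hand side \<open>g\<^sub>+\<close> for the adjoint extension, then
  \<open>(z - \<i>) f + g\<^sub>+\<close> lies in \<open>Ker (T* - z)\<close>, so its coefficients are in the ratio that \<open>e\<close>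
  prescribes. Together with the boundary condition satisfied by \<open>f\<close> this is a linear system for the
  coefficients of \<open>f\<close>, and the one at \<open>g\<^sub>+\<close> determines the Weyl-Titchmarsh function. The argument
  does not divide by \<open>z - \<i>\<close>, so it covers \<open>z = \<i>\<close> as well.
\<close>

lemma weyl_titchmarsh_extension:
  assumes k: "cmod \<kappa> < 1" and z: "Im z > 0"
    and e: "(e, z *\<^sub>C e) \<in> op_adjoint T" "e \<noteq> 0"
    and s: "s = - (coef_minus e (z *\<^sub>C e) / coef_plus e (z *\<^sub>C e))"
  shows "cnj \<kappa> * s \<noteq> 1"
    and "weyl_titchmarsh_function (extension \<kappa>) gp z = \<i> + 2 * \<i> * cnj \<kappa> * s / (1 - cnj \<kappa> * s)"
proof -
  define a b where "a = coef_plus e (z *\<^sub>C e)" and "b = coef_minus e (z *\<^sub>C e)"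
  have ab: "cmod b < cmod a" using eigenvector_coef_less[OF z e] by (simp add: a_def b_def)
  then have a0: "a \<noteq> 0" by auto
  have sb: "b = - s * a" using a0 by (simp add: s a_def b_def)
  have "cmod s < 1" using ab a0 by (simp add: s norm_divide flip: a_def b_def)
  then have "cmod (cnj \<kappa> * s) < 1"
    using k by (metis complex_mod_cnj mult_less_cancel_right2 mult_strict_mono norm_ge_zero
        norm_mult mult_1 zero_less_one)
  then show ks: "cnj \<kappa> * s \<noteq> 1" by auto
  obtain f where f: "(f, gp + z *\<^sub>C f) \<in> op_adjoint (extension \<kappa>)"
    and res: "op_apply (resolvent_op (op_adjoint (extension \<kappa>)) z) gp = f"
    and app: "op_apply (op_adjoint (extension \<kappa>)) f = gp + z *\<^sub>C f"
    using resolvent_adjoint_extension[OF k z e] .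
  define X Y where "X = coef_plus f (gp + z *\<^sub>C f)" and "Y = coef_minus f (gp + z *\<^sub>C f)"
  have fT: "(f, gp + z *\<^sub>C f) \<in> op_adjoint T" and XY: "X = - cnj \<kappa> * Y"
    using f by (auto simp: op_adjoint_extension X_def Y_def)
  have "(z + \<i>) * cinner f gp = 2 * \<i> * X - 1"
    by (simp add: X_def coef_plus_def cinner_linear cinner_self norm_gp field_simps)
  moreover have "weyl_titchmarsh_function (extension \<kappa>) gp z = z + (z * z + 1) * cinner f gp"
    by (simp add: weyl_titchmarsh_function_def res app cinner_linear cinner_self norm_gp
        algebra_simps)
  moreover have "z * z + 1 = (z - \<i>) * (z + \<i>)" by (simp add: algebra_simps)
  ultimately have "weyl_titchmarsh_function (extension \<kappa>) gp z = z + (z - \<i>) * (2 * \<i> * X - 1)"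
    by (simp only: mult.assoc)
  then have M: "weyl_titchmarsh_function (extension \<kappa>) gp z = \<i> + 2 * \<i> * ((z - \<i>) * X)"
    by (simp add: algebra_simps)
  define k where "k = (z - \<i>) *\<^sub>C f + gp"
  have zk: "z *\<^sub>C k = (z - \<i>) *\<^sub>C (gp + z *\<^sub>C f) + \<i> *\<^sub>C gp"
    by (simp add: k_def scaleC_distribs algebra_simps)
  have kT: "(k, z *\<^sub>C k) \<in> op_adjoint T"
    unfolding zk unfolding k_def using fT gp by (intro op_adjoint_add op_adjoint_scaleC)
  have "coef_plus k (z *\<^sub>C k) = (z - \<i>) * X + 1" "coef_minus k (z *\<^sub>C k) = (z - \<i>) * Y"
    unfolding zk unfolding k_def coef_plus_linear coef_minus_linear by (simp_all add: X_def Y_def coefs_gp)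
  then have "((z - \<i>) * X + 1) * b = a * ((z - \<i>) * Y)"
    using eigenvector_coef_ratio[OF z e(1) kT] by (simp add: a_def b_def)
  then have "a * ((z - \<i>) * Y * (1 - cnj \<kappa> * s)) = a * (- s)"
    unfolding XY sb by algebra
  then have "(z - \<i>) * Y * (1 - cnj \<kappa> * s) = - s"
    using a0 by (metis mult_left_cancel)
  then have "(z - \<i>) * Y = - s / (1 - cnj \<kappa> * s)"
    using ks by (subst nonzero_eq_divide_eq) auto
  moreover have "(z - \<i>) * X = - cnj \<kappa> * ((z - \<i>) * Y)" by (simp add: XY)
  ultimately have "(z - \<i>) * X = cnj \<kappa> * s / (1 - cnj \<kappa> * s)" by simp
  then show "weyl_titchmarsh_function (extension \<kappa>) gp z
      = \<i> + 2 * \<i> * cnj \<kappa> * s / (1 - cnj \<kappa> * s)"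
    unfolding M by simp
qed

end

section \<open>The relation between the two functions\<close>

theorem theorem4p3:
  fixes Adot A Ahat :: "('a::complex_hilbert_space \<times> 'a) set"
    and gp gm :: 'a
    and g :: "complex \<Rightarrow> 'a"
  assumes "symmetric_operator Adot" and "closed Adot" and "densely_defined Adot"
    and "deficiency_indices Adot = (1, 1)"
    and "self_adjoint_operator A" and "Adot \<subseteq> A"
    and "maximal_dissipative_extension Adot Ahat" and "Ahat \<noteq> op_adjoint Ahat"
    and "gp \<in> eigenspace_op (op_adjoint Adot) \<i>" and "norm gp = 1"
    and "gm \<in> eigenspace_op (op_adjoint Adot) (- \<i>)" and "norm gm = 1"
    and "gp - gm \<in> Domain A"
    and "\<And>z. Im z > 0 \<Longrightarrow> g z \<noteq> 0 \<and> g z \<in> eigenspace_op (op_adjoint Adot) z"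
  shows "let S = characteristic_function Ahat gp gm g;
             M = weyl_titchmarsh_function Ahat gp;
             \<kappa> = S \<i>
         in \<forall>z. Im z > 0 \<longrightarrow>
              cnj \<kappa> * S z = (of_real ((cmod \<kappa>)\<^sup>2) - 1) / (2 * \<i>) * M z
                           + (of_real ((cmod \<kappa>)\<^sup>2) + 1) / 2"
proof -
  have dims: "cvec.dim (eigenspace_op (op_adjoint Adot) \<i>) = 1"
    "cvec.dim (eigenspace_op (op_adjoint Adot) (- \<i>)) = 1"
    using assms(4) by (simp_all add: deficiency_indices_def)
  have nz: "gp \<noteq> 0" "gm \<noteq> 0" using assms(10,12) by auto
  interpret deficiency_one Adot gp gm
  proof
    show "\<exists>c. f = c *\<^sub>C gp" if "(f, \<i> *\<^sub>C f) \<in> op_adjoint Adot" for f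
      using eigenspace_spanned[OF dims(1) assms(9) nz(1)] that
      by (metis eigenspace_op_def mem_Collect_eq)
    show "\<exists>c. f = c *\<^sub>C gm" if "(f, (- \<i>) *\<^sub>C f) \<in> op_adjoint Adot" for f
      using eigenspace_spanned[OF dims(2) assms(11) nz(2)] that
      by (metis eigenspace_op_def mem_Collect_eq)
  qed (use assms in \<open>auto simp: eigenspace_op_def\<close>)
  obtain \<kappa> where le: "cmod \<kappa> \<le> 1" and Ahat: "Ahat = extension \<kappa>"
    using maximal_dissipative_eq_extension[OF assms(7)] .
  have k: "cmod \<kappa> < 1"
    using le extension_self_adjoint[of \<kappa>] assms(8) unfolding Ahat by force
  define s where "s = livsic_function gp gm g"
  have S: "characteristic_function Ahat gp gm g z = (s z - \<kappa>) / (cnj \<kappa> * s z - 1)" for z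
    by (simp add: characteristic_function_def Let_def Ahat von_neumann_parameter_extension[OF k] s_def)
  have "s \<i> = 0" by (simp add: s_def livsic_function_def)
  then have Si: "characteristic_function Ahat gp gm g \<i> = \<kappa>" by (simp add: S)
  have kk: "complex_of_real ((cmod \<kappa>)\<^sup>2) = \<kappa> * cnj \<kappa>" by (rule complex_norm_square)
  have "cnj \<kappa> * ((s z - \<kappa>) / (cnj \<kappa> * s z - 1))
      = (\<kappa> * cnj \<kappa> - 1) / (2 * \<i>) * weyl_titchmarsh_function Ahat gp z + (\<kappa> * cnj \<kappa> + 1) / 2"
    if z: "Im z > 0" for z
  proof -
    have e: "(g z, z *\<^sub>C g z) \<in> op_adjoint Adot" "g z \<noteq> 0"
      using assms(14)[OF z] by (auto simp: eigenspace_op_def)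
    note W = weyl_titchmarsh_extension[OF k z e livsic_function_coefs[of g z], folded s_def]
    define x where "x = cnj \<kappa> * s z"
    have x: "x - 1 \<noteq> 0" "1 - x \<noteq> 0" using W(1) by (auto simp: x_def)
    have M: "weyl_titchmarsh_function Ahat gp z = \<i> + 2 * \<i> * x / (1 - x)"
      using W(2) by (simp add: Ahat x_def mult.assoc)
    have "cnj \<kappa> * ((s z - \<kappa>) / (x - 1)) = (x - \<kappa> * cnj \<kappa>) / (x - 1)"
      by (simp add: x_def algebra_simps)
    also have "\<dots> = (\<kappa> * cnj \<kappa> - 1) / (2 * \<i>) * (\<i> + 2 * \<i> * x / (1 - x)) + (\<kappa> * cnj \<kappa> + 1) / 2"
      using x by (simp add: divide_simps) (simp add: algebra_simps)
    finally show ?thesis by (simp add: M x_def)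
  qed
  then show ?thesis
    unfolding Let_def Si kk unfolding S by blast
qed

end
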